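(* Let $F:\mathbb{T}^N\to\mathbb{R}^N$ be a $C^2$ vector field with $F\in\mathcal{V}_{\mathrm{pair}}$, and let $\Phi:\mathbb{T}^N\to\mathbb{T}^N$ be a node-respecting diffeomorphism. Then the pushforward vector field $\Phi_*F$ also belongs to $\mathcal{V}_{\mathrm{pair}}$.
   Context: $\mathbb{T}=\mathbb{R}/2\pi\mathbb{Z}$. Pairwise class: a $C^2$ vector field $F=(F_1,\dots,F_N):\mathbb{T}^N\to\mathbb{R}^N$ is pairwise, written $F\in\mathcal{V}_{\mathrm{pair}}$, if for each $i\in\{1,\dots,N\}$ there exist functions $G_{ij}\in C^2(\mathbb{T}^2,\mathbb{R})$, $j=1,\dots,N$, with $F_i(\theta)=\sum_{j=1}^N G_{ij}(\theta_i,\theta_j)$ for all $\theta\in\mathbb{T}^N$. A diffeomorphism $\Phi:\mathbb{T}^N\to\mathbb{T}^N$ is node-respecting if it has the form $\Phi(\theta_1,\dots,\theta_N)=(\phi_1(\theta_{\sigma(1)}),\dots,\phi_N(\theta_{\sigma(N)}))$, where $\sigma$ is a permutation of $\{1,\dots,N\}$ and each $\phi_i:\mathbb{T}\to\mathbb{T}$ is a $C^3$ diffeomorphism. The pushforward is $(\Phi_*F)(y)=D\Phi(\Phi^{-1}(y))\,F(\Phi^{-1}(y))$, using the canonical identification of the tangent spaces of $\mathbb{T}^N$ with $\mathbb{R}^N$. *)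

theory Defs
  imports "HOL-Analysis.Analysis"
begin

definition angle_rel :: "real \<Rightarrow> real \<Rightarrow> bool" where
  "angle_rel x y \<longleftrightarrow> (\<exists>k::int. x - y = 2 * pi * of_int k)"

lemma equivp_angle_rel: "equivp angle_rel"
proof (rule equivpI)
  show "reflp angle_rel"
    unfolding reflp_def angle_rel_def by (auto intro: exI[of _ 0])
  show "symp angle_rel"
    unfolding symp_def angle_rel_def
    by (metis minus_diff_eq mult_minus_right of_int_minus)
  show "transp angle_rel"
  proof (rule transpI)
    fix x y z assume "angle_rel x y" "angle_rel y z"
    then obtain k l :: int where "x - y = 2 * pi * of_int k" "y - z = 2 * pi * of_int l"
      unfolding angle_rel_def by blast
    then have "x - z = 2 * pi * of_int (k + l)"
      by (simp add: algebra_simps)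
    then show "angle_rel x z"
      unfolding angle_rel_def by blast
  qed
qed

quotient_type circle = real / angle_rel
  morphisms angle_of circ
  by (rule equivp_angle_rel)

definition torus_proj :: "real ^ 'n \<Rightarrow> circle ^ 'n" where
  "torus_proj x = (\<chi> i. circ (x $ i))"

definition torus2_proj :: "real \<times> real \<Rightarrow> circle \<times> circle" where
  "torus2_proj = map_prod circ circ"

text \<open>
  \<open>Ck_on k S f\<close>: for open \<open>S\<close>, the map \<open>f\<close> is of class $C^k$ on \<open>S\<close>.  All directional
  derivatives are required to be $C^{k-1}$, which in finite dimension is the same as
  requiring it of the derivative as an operator-valued map.
\<close>

primrec Ck_on ::
  "nat \<Rightarrow> 'a::euclidean_space set \<Rightarrow> ('a \<Rightarrow> 'b::euclidean_space) \<Rightarrow> bool" where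
  "Ck_on 0 S f \<longleftrightarrow> continuous_on S f"
| "Ck_on (Suc k) S f \<longleftrightarrow>
     (\<forall>x\<in>S. f differentiable (at x)) \<and>
     (\<forall>v. Ck_on k S (\<lambda>x. frechet_derivative f (at x) v))"

text \<open>
  The smooth structures on the circle and the tori are the ones for which the projections
  \<open>circ\<close>, \<open>torus2_proj\<close> and \<open>torus_proj\<close> are local diffeomorphisms, so that the local inverses
  of a projection are charts.  A real- or vector-valued function is therefore $C^k$ iff its
  composition with the projection is, and a map between such spaces is $C^k$ iff around every
  point it is represented by a $C^k$ map of the covering Euclidean spaces.  Below, \<open>p\<close> and \<open>q\<close>
  stand for these projections.
\<close>

definition Ck_fun ::
  "('a::euclidean_space \<Rightarrow> 'm) \<Rightarrow> nat \<Rightarrow> ('m \<Rightarrow> 'b::euclidean_space) \<Rightarrow> bool" where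
  "Ck_fun p k f \<longleftrightarrow> Ck_on k UNIV (f \<circ> p)"

definition local_lift ::
  "('a::euclidean_space \<Rightarrow> 'm) \<Rightarrow> ('b::euclidean_space \<Rightarrow> 'm') \<Rightarrow> ('m \<Rightarrow> 'm') \<Rightarrow> 'a set \<Rightarrow> ('a \<Rightarrow> 'b) \<Rightarrow> bool"
  where
  "local_lift p q \<phi> U g \<longleftrightarrow> open U \<and> (\<forall>u\<in>U. \<phi> (p u) = q (g u))"

definition Ck_map ::
  "('a::euclidean_space \<Rightarrow> 'm) \<Rightarrow> ('b::euclidean_space \<Rightarrow> 'm') \<Rightarrow> nat \<Rightarrow> ('m \<Rightarrow> 'm') \<Rightarrow> bool" where
  "Ck_map p q k \<phi> \<longleftrightarrow> (\<forall>x. \<exists>U g. x \<in> U \<and> local_lift p q \<phi> U g \<and> Ck_on k U g)"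

definition Ck_diffeo :: "('a::euclidean_space \<Rightarrow> 'm) \<Rightarrow> nat \<Rightarrow> ('m \<Rightarrow> 'm) \<Rightarrow> bool" where
  "Ck_diffeo p k \<phi> \<longleftrightarrow> bij \<phi> \<and> Ck_map p p k \<phi> \<and> Ck_map p p k (inv \<phi>)"

definition V_pair :: "(circle ^ 'n \<Rightarrow> real ^ 'n) set" where
  "V_pair = {F. Ck_fun torus_proj 2 F \<and>
     (\<forall>i. \<exists>G :: 'n \<Rightarrow> circle \<times> circle \<Rightarrow> real.
        (\<forall>j. Ck_fun torus2_proj 2 (G j)) \<and>
        (\<forall>\<theta>. F \<theta> $ i = (\<Sum>j\<in>UNIV. G j (\<theta> $ i, \<theta> $ j))))}"

text \<open>
  \<open>\<Phi>\<close> itself is only asked to be a $C^1$ diffeomorphism, which is what its derivative needs;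
  any higher regularity comes from the $C^3$ circle diffeomorphisms \<open>\<phi> i\<close>.
\<close>

definition node_respecting :: "(circle ^ 'n \<Rightarrow> circle ^ 'n) \<Rightarrow> bool" where
  "node_respecting \<Phi> \<longleftrightarrow> Ck_diffeo torus_proj 1 \<Phi> \<and>
     (\<exists>(\<sigma> :: 'n \<Rightarrow> 'n) (\<phi> :: 'n \<Rightarrow> circle \<Rightarrow> circle).
        \<sigma> permutes UNIV \<and> (\<forall>i. Ck_diffeo circ 3 (\<phi> i)) \<and>
        (\<forall>\<theta>. \<Phi> \<theta> = (\<chi> i. \<phi> i (\<theta> $ \<sigma> i))))"

text \<open>
  The derivative \<open>D\<Phi>(a)\<close>, with every tangent space of the torus identified with \<open>\<real>\<^sup>N\<close> through
  the derivative of \<open>torus_proj\<close>.  It is unique where it exists: any two lifts differentiable at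
  points over \<open>a\<close> agree near these points up to translation by elements of \<open>2\<pi>\<int>\<^sup>N\<close> in the domain
  and in the codomain.
\<close>

definition torus_deriv ::
  "(circle ^ 'n \<Rightarrow> circle ^ 'n) \<Rightarrow> circle ^ 'n \<Rightarrow> real ^ 'n \<Rightarrow> real ^ 'n" where
  "torus_deriv \<Phi> a = (THE L. \<exists>x U g. torus_proj x = a \<and> x \<in> U \<and>
     local_lift torus_proj torus_proj \<Phi> U g \<and> (g has_derivative L) (at x))"

definition pushforward ::
  "(circle ^ 'n \<Rightarrow> circle ^ 'n) \<Rightarrow> (circle ^ 'n \<Rightarrow> real ^ 'n) \<Rightarrow> circle ^ 'n \<Rightarrow> real ^ 'n" where
  "pushforward \<Phi> F y = torus_deriv \<Phi> (inv \<Phi> y) (F (inv \<Phi> y))"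

end

theory Submission
  imports Defs
begin

text \<open>
  On the circle the derivative \<open>\<phi>'\<close> of a \<open>C\<^sup>3\<close> map is a well-defined \<open>C\<^sup>2\<close> function, because two
  lifts of the same map differ locally by a constant.  The derivative of a node-respecting \<open>\<Phi>\<close>
  is a weighted permutation matrix, and with \<open>\<psi> i = (\<phi> i)\<^sup>-\<^sup>1\<close> one has
  \<open>(inv \<Phi> y)\<^sub>\<sigma>\<^sub>i = \<psi> i (y\<^sub>i)\<close>, so that reindexing the interaction sum by \<open>j = \<sigma> k\<close> gives
  \<open>(\<Phi>\<^sub>*F)\<^sub>i(y) = (\<Sum>k. \<phi> i'(\<psi> i (y\<^sub>i)) \<sqdot> G (\<sigma> i) (\<sigma> k) (\<psi> i (y\<^sub>i), \<psi> k (y\<^sub>k)))\<close>.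
\<close>

section \<open>Calculus of \<open>C\<^sup>k\<close> maps\<close>

text \<open>On an open set, agreement at all points is agreement near each point, so the two
  functions share their derivatives; the induction then passes to directional derivatives.\<close>

lemma Ck_on_cong:
  assumes "open S" "\<And>x. x \<in> S \<Longrightarrow> f x = g x" "Ck_on k S f"
  shows "Ck_on k S g"
  using assms(2,3)
proof (induction k arbitrary: f g)
  case 0
  then show ?case
    using continuous_on_cong[of S S f g] by simp
next
  case (Suc k)
  have der: "(g has_derivative frechet_derivative f (at x)) (at x)" if "x \<in> S" for x
    using has_derivative_transform_within_open[OF _ assms(1) that Suc.prems(1)]
      Suc.prems(2) that by (simp add: frechet_derivative_works)
  have "Ck_on k S (\<lambda>x. frechet_derivative g (at x) v)" for v
  proof (rule Suc.IH)
    show "Ck_on k S (\<lambda>x. frechet_derivative f (at x) v)"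
      using Suc.prems(2) by simp
    show "frechet_derivative f (at x) v = frechet_derivative g (at x) v" if "x \<in> S" for x
      using frechet_derivative_at[OF der[OF that]] by simp
  qed
  then show ?case
    using der by (auto simp: differentiable_def)
qed

text \<open>Lets any explicit formula for the derivative stand in for
  \<open>frechet_derivative\<close>, so that the closure properties follow by induction from the
  usual differentiation rules.\<close>

lemma Ck_on_SucI:
  assumes "open S" "\<And>x. x \<in> S \<Longrightarrow> (f has_derivative f' x) (at x)"
    and "\<And>v. Ck_on k S (\<lambda>x. f' x v)"
  shows "Ck_on (Suc k) S f"
  unfolding Ck_on.simps
proof (intro conjI ballI allI)
  show "f differentiable at x" if "x \<in> S" for x
    using assms(2)[OF that] by (auto simp: differentiable_def)
  show "Ck_on k S (\<lambda>x. frechet_derivative f (at x) v)" for v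
    by (rule Ck_on_cong[OF assms(1) _ assms(3)[of v]])
      (simp add: frechet_derivative_at[OF assms(2), symmetric])
qed

lemma Ck_on_SucD:
  assumes "Ck_on (Suc k) S f"
  shows "\<And>x. x \<in> S \<Longrightarrow> (f has_derivative frechet_derivative f (at x)) (at x)"
    and "\<And>v. Ck_on k S (\<lambda>x. frechet_derivative f (at x) v)"
  using assms by (auto simp: frechet_derivative_works)

lemma Ck_on_Suc_imp: "Ck_on (Suc k) S f \<Longrightarrow> Ck_on k S f"
proof (induction k arbitrary: f)
  case 0
  then show ?case
    by (auto intro!: continuous_at_imp_continuous_on differentiable_imp_continuous_within)
next
  case (Suc k)
  then show ?case by (metis Ck_on.simps(2))
qed

lemma Ck_on_le: "Ck_on m S f \<Longrightarrow> k \<le> m \<Longrightarrow> Ck_on k S f"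
  by (induction m) (auto simp: le_Suc_eq simp del: Ck_on.simps intro: Ck_on_Suc_imp)

lemma Ck_on_subset: "Ck_on k S f \<Longrightarrow> T \<subseteq> S \<Longrightarrow> Ck_on k T f"
  by (induction k arbitrary: f) (auto intro: continuous_on_subset)

text \<open>Lifts of a circle map exist only locally and vary with the point; this assembles the
  local regularity they give.\<close>

lemma Ck_on_local:
  assumes "\<And>x. x \<in> S \<Longrightarrow> \<exists>U. open U \<and> x \<in> U \<and> Ck_on k U f"
  shows "Ck_on k S f"
  using assms
proof (induction k arbitrary: f)
  case 0
  have "isCont f x" if "x \<in> S" for x
    using 0[OF that] by (auto simp: continuous_on_eq_continuous_at)
  then show ?case
    by (simp add: continuous_at_imp_continuous_on)
next
  case (Suc k)
  have "Ck_on k S (\<lambda>x. frechet_derivative f (at x) v)" for v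
    by (rule Suc.IH) (use Suc.prems in fastforce)
  moreover have "\<forall>x\<in>S. f differentiable at x"
    using Suc.prems by fastforce
  ultimately show ?case by simp
qed

lemma Ck_on_const: "open S \<Longrightarrow> Ck_on k S (\<lambda>x. c)"
  by (induction k arbitrary: c)
    (auto simp del: Ck_on.simps(2) intro!: Ck_on_SucI derivative_eq_intros)

lemma Ck_on_linear:
  assumes "bounded_linear L" "open S"
  shows "Ck_on k S L"
proof (cases k)
  case 0
  then show ?thesis
    using linear_continuous_on[OF assms(1)] by simp
next
  case (Suc m)
  show ?thesis
    unfolding Suc
    by (rule Ck_on_SucI[OF assms(2) bounded_linear_imp_has_derivative[OF assms(1)]])
      (rule Ck_on_const[OF assms(2)])
qed

lemma Ck_on_linear_compose:
  assumes "bounded_linear L" "open S" "Ck_on k S f"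
  shows "Ck_on k S (\<lambda>x. L (f x))"
  using assms(3)
proof (induction k arbitrary: f)
  case 0
  then show ?case
    using bounded_linear.continuous_on[OF assms(1)] by simp
next
  case (Suc k)
  show ?case
    by (rule Ck_on_SucI[OF assms(2)])
      (rule bounded_linear.has_derivative[OF assms(1)] Ck_on_SucD[OF Suc.prems] Suc.IH
        | assumption)+
qed

lemma Ck_on_add:
  assumes "open S" "Ck_on k S f" "Ck_on k S g"
  shows "Ck_on k S (\<lambda>x. f x + g x)"
  using assms(2,3)
proof (induction k arbitrary: f g)
  case 0
  then show ?case by (simp add: continuous_on_add)
next
  case (Suc k)
  show ?case
    by (rule Ck_on_SucI[OF assms(1)])
      (rule has_derivative_add Ck_on_SucD[OF Suc.prems(1)] Ck_on_SucD[OF Suc.prems(2)] Suc.IH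
        | assumption)+
qed

lemma Ck_on_sum:
  assumes "open S" "\<And>i. i \<in> A \<Longrightarrow> Ck_on k S (f i)"
  shows "Ck_on k S (\<lambda>x. \<Sum>i\<in>A. f i x)"
  using assms(2)
  by (induction A rule: infinite_finite_induct)
    (auto intro: Ck_on_const Ck_on_add assms(1))

lemma Ck_on_scaleR:
  assumes "open S" "Ck_on k S f" "Ck_on k S g"
  shows "Ck_on k S (\<lambda>x. f x *\<^sub>R g x)"
  using assms(2,3)
proof (induction k arbitrary: f g)
  case 0
  then show ?case by (simp add: continuous_on_scaleR)
next
  case (Suc k)
  \<comment> \<open>The product rule leaves one factor undifferentiated in each term, so the factors
    themselves are lowered by one order before the induction hypothesis applies.\<close>
  show ?case
    by (rule Ck_on_SucI[OF assms(1)])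
      (rule has_derivative_scaleR Ck_on_add assms(1) Ck_on_SucD[OF Suc.prems(1)]
        Ck_on_SucD[OF Suc.prems(2)] Suc.IH Ck_on_Suc_imp[OF Suc.prems(1)]
        Ck_on_Suc_imp[OF Suc.prems(2)]
        | assumption)+
qed

lemma Ck_on_Pair:
  assumes "open S" "Ck_on k S f" "Ck_on k S g"
  shows "Ck_on k S (\<lambda>x. (f x, g x))"
proof -
  have "Ck_on k S (\<lambda>x. (f x, 0) + (0, g x))"
    by (intro Ck_on_add assms Ck_on_linear_compose[of "\<lambda>x. (x, 0)"]
        Ck_on_linear_compose[of "\<lambda>x. (0, x)"] bounded_linear_Pair
        bounded_linear_ident bounded_linear_zero)
  then show ?thesis by simp
qed

text \<open>The chain rule produces \<open>?f' (g x) (?g' x v)\<close>, whose direction moves with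
  \<open>x\<close>, whereas \<open>Ck_on\<close> speaks of fixed directions. Expanding
  \<open>?g' x v\<close> in the basis leaves products of C^k coefficients with
  \<open>?f' (g x) b\<close>, and the induction hypothesis treats the latter as compositions with
  \<open>g\<close>.\<close>

lemma Ck_on_compose:
  assumes "open S" "Ck_on k S g" "Ck_on k T f" "g ` S \<subseteq> T"
  shows "Ck_on k S (\<lambda>x. f (g x))"
  using assms(2,3)
proof (induction k arbitrary: f)
  case 0
  then show ?case
    using assms(4) continuous_on_compose2 by auto
next
  case (Suc k)
  let ?f' = "\<lambda>y. frechet_derivative f (at y)" and ?g' = "\<lambda>x. frechet_derivative g (at x)"
  note g' = Ck_on_SucD[OF Suc.prems(1)] and f' = Ck_on_SucD[OF Suc.prems(2)]
  have gT: "g x \<in> T" if "x \<in> S" for x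
    using assms(4) that by blast
  have expand: "?f' (g x) (?g' x v) = (\<Sum>b\<in>Basis. (?g' x v \<bullet> b) *\<^sub>R ?f' (g x) b)"
    if "x \<in> S" for x v
  proof -
    interpret bounded_linear "?f' (g x)"
      using f'(1)[OF gT[OF that]] by (rule has_derivative_bounded_linear)
    have "?f' (g x) (?g' x v) = ?f' (g x) (\<Sum>b\<in>Basis. (?g' x v \<bullet> b) *\<^sub>R b)"
      by (simp add: euclidean_representation)
    then show ?thesis
      by (simp add: sum scaleR)
  qed
  show ?case
  proof (rule Ck_on_SucI[OF assms(1)])
    show "((\<lambda>x. f (g x)) has_derivative (\<lambda>v. ?f' (g x) (?g' x v))) (at x)" if "x \<in> S" for x
      using has_derivative_compose[OF g'(1)[OF that] f'(1)[OF gT[OF that]]] .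
    show "Ck_on k S (\<lambda>x. ?f' (g x) (?g' x v))" for v
    proof (rule Ck_on_cong[OF assms(1)])
      show "Ck_on k S (\<lambda>x. \<Sum>b\<in>Basis. (?g' x v \<bullet> b) *\<^sub>R ?f' (g x) b)"
        by (intro Ck_on_sum Ck_on_scaleR assms(1) Suc.IH Ck_on_Suc_imp[OF Suc.prems(1)] f'(2)
            Ck_on_linear_compose[OF bounded_linear_inner_left] g'(2))
    qed (simp add: expand)
  qed
qed

section \<open>Maps between quotients\<close>

lemma Ck_fun_localI:
  assumes "\<And>x. \<exists>U g. open U \<and> x \<in> U \<and> Ck_on k U g \<and> (\<forall>u\<in>U. f (p u) = g u)"
  shows "Ck_fun p k f"
  unfolding Ck_fun_def
proof (rule Ck_on_local)
  fix x
  obtain U g where "open U" "x \<in> U" "Ck_on k U g" "\<forall>u\<in>U. f (p u) = g u"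
    using assms by blast
  then show "\<exists>U. open U \<and> x \<in> U \<and> Ck_on k U (f \<circ> p)"
    using Ck_on_cong[of U g "f \<circ> p" k] by auto
qed

text \<open>Near each point, \<open>f\<close> after \<open>\<phi>\<close> after \<open>p\<close>
  equals \<open>f \<circ> q\<close> after a local lift of \<open>\<phi>\<close>, a composition of
  Euclidean C^k maps.\<close>

lemma Ck_fun_compose:
  assumes "Ck_map p q k \<phi>" "Ck_fun q k f"
  shows "Ck_fun p k (\<lambda>x. f (\<phi> x))"
proof (rule Ck_fun_localI)
  fix x
  obtain U g where "x \<in> U" "local_lift p q \<phi> U g" "Ck_on k U g"
    using assms(1) unfolding Ck_map_def by blast
  then show "\<exists>U g. open U \<and> x \<in> U \<and> Ck_on k U g \<and> (\<forall>u\<in>U. f (\<phi> (p u)) = g u)"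
    using assms(2) Ck_on_compose[of U k g UNIV "f \<circ> q"]
    by (intro exI[of _ U] exI[of _ "\<lambda>u. f (q (g u))"])
      (auto simp: local_lift_def Ck_fun_def)
qed

lemma Ck_map_compose:
  assumes "Ck_map p q k \<phi>" "Ck_map q r k \<psi>"
  shows "Ck_map p r k (\<lambda>x. \<psi> (\<phi> x))"
  unfolding Ck_map_def
proof
  fix x
  obtain U g where U: "x \<in> U" "local_lift p q \<phi> U g" "Ck_on k U g"
    using assms(1) unfolding Ck_map_def by blast
  obtain V h where V: "g x \<in> V" "local_lift q r \<psi> V h" "Ck_on k V h"
    using assms(2) unfolding Ck_map_def by blast
  \<comment> \<open>The first lift is restricted to the points it sends into the domain of the
    second; continuity of \<open>g\<close> keeps this set open.\<close>
  let ?W = "U \<inter> g -` V"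
  have "continuous_on U g"
    using Ck_on_le[OF U(3), of 0] by simp
  then have W: "open ?W"
    using U(2) V(2) unfolding local_lift_def
    by (simp add: continuous_on_open_vimage Int_commute)
  show "\<exists>U g. x \<in> U \<and> local_lift p r (\<lambda>x. \<psi> (\<phi> x)) U g \<and> Ck_on k U g"
  proof (intro exI conjI)
    show "x \<in> ?W"
      using U(1) V(1) by simp
    show "local_lift p r (\<lambda>x. \<psi> (\<phi> x)) ?W (\<lambda>u. h (g u))"
      using U(2) V(2) W by (auto simp: local_lift_def)
    show "Ck_on k ?W (\<lambda>u. h (g u))"
      by (rule Ck_on_compose[OF W Ck_on_subset[OF U(3)] V(3)]) auto
  qed
qed

lemma Ck_map_Pair:
  assumes "Ck_map p circ k f" "Ck_map p circ k g"
  shows "Ck_map p torus2_proj k (\<lambda>x. (f x, g x))"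
  unfolding Ck_map_def
proof
  fix x
  obtain U a where U: "x \<in> U" "local_lift p circ f U a" "Ck_on k U a"
    using assms(1) unfolding Ck_map_def by blast
  obtain V b where V: "x \<in> V" "local_lift p circ g V b" "Ck_on k V b"
    using assms(2) unfolding Ck_map_def by blast
  show "\<exists>U h. x \<in> U \<and> local_lift p torus2_proj (\<lambda>x. (f x, g x)) U h \<and> Ck_on k U h"
    using U V
    by (intro exI[of _ "U \<inter> V"] exI[of _ "\<lambda>u. (a u, b u)"] conjI Ck_on_Pair)
      (auto simp: local_lift_def torus2_proj_def intro: Ck_on_subset)
qed

lemma Ck_map_linear:
  assumes "bounded_linear L" "\<And>u. \<phi> (p u) = q (L u)"
  shows "Ck_map p q k \<phi>"
  unfolding Ck_map_def using assms Ck_on_linear[OF assms(1) open_UNIV, of k]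
  by (auto simp: local_lift_def intro!: exI[of _ UNIV] exI[of _ L])

lemma Ck_map_fst: "Ck_map torus2_proj circ k fst"
  and Ck_map_snd: "Ck_map torus2_proj circ k snd"
  by (rule Ck_map_linear[OF bounded_linear_fst] Ck_map_linear[OF bounded_linear_snd],
      simp add: torus2_proj_def)+

lemma Ck_map_nth: "Ck_map torus_proj circ k (\<lambda>\<theta>. \<theta> $ i)"
  by (rule Ck_map_linear[OF bounded_linear_vec_nth]) (simp add: torus_proj_def)

lemma Ck_map_le: "Ck_map p q m \<phi> \<Longrightarrow> k \<le> m \<Longrightarrow> Ck_map p q k \<phi>"
  unfolding Ck_map_def by (meson Ck_on_le)

lemma Ck_fun_mult:
  fixes f g :: "'m \<Rightarrow> real"
  shows "Ck_fun p k f \<Longrightarrow> Ck_fun p k g \<Longrightarrow> Ck_fun p k (\<lambda>x. f x * g x)"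
  using Ck_on_scaleR[OF open_UNIV, of k "f \<circ> p" "g \<circ> p"]
  by (simp add: Ck_fun_def o_def)

lemma Ck_fun_sum:
  "(\<And>i. i \<in> A \<Longrightarrow> Ck_fun p k (f i)) \<Longrightarrow> Ck_fun p k (\<lambda>x. \<Sum>i\<in>A. f i x)"
  using Ck_on_sum[OF open_UNIV, of A k "\<lambda>i. f i \<circ> p"]
  by (simp add: Ck_fun_def o_def)

lemma Ck_fun_vec:
  fixes f :: "'n::finite \<Rightarrow> 'm \<Rightarrow> real"
  assumes "\<And>i. Ck_fun p k (f i)"
  shows "Ck_fun p k (\<lambda>x. \<chi> i. f i x)"
proof -
  \<comment> \<open>A vector is the sum of its coordinates times the vectors
    \<open>axis i 1\<close>, which reduces the claim to scalar multiples and sums.\<close>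
  have "Ck_on k UNIV (\<lambda>u. \<Sum>i\<in>UNIV. f i (p u) *\<^sub>R axis i (1::real))"
    using assms
    by (intro Ck_on_sum Ck_on_scaleR Ck_on_const) (auto simp: Ck_fun_def o_def)
  moreover have "(\<Sum>i\<in>UNIV. f i y *\<^sub>R axis i (1::real)) = (\<chi> i. f i y)" for y
    by (simp add: vec_eq_iff axis_def if_distrib[of "\<lambda>x. _ * x"] cong: if_cong)
  ultimately show ?thesis
    by (simp add: Ck_fun_def o_def)
qed

section \<open>Derivatives of lifts\<close>

lemma circ_eq_iff: "circ x = circ y \<longleftrightarrow> (\<exists>k::int. x - y = 2 * pi * of_int k)"
  by (simp add: circle.abs_eq_iff angle_rel_def)

lemma surj_circ: "\<exists>x. circ x = a"
  using Quotient3_abs_rep[OF Quotient3_circle] by blast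

text \<open>The difference of the two lifts is continuous with values in \<open>2\<pi>\<int>\<close>, hence locally constant.\<close>

lemma lift_derivative_unique:
  fixes f g :: "'a::real_normed_vector \<Rightarrow> real"
  assumes "open U" "x \<in> U" "\<And>u. u \<in> U \<Longrightarrow> circ (f u) = circ (g u)"
    and f: "(f has_derivative f') (at x)" and g: "(g has_derivative g') (at x)"
  shows "f' = g'"
proof -
  let ?h = "\<lambda>u. f u - g u"
  have h: "(?h has_derivative (\<lambda>v. f' v - g' v)) (at x)"
    by (rule has_derivative_diff[OF f g])
  then have "isCont ?h x"
    by (rule has_derivative_continuous)
  \<comment> \<open>The bound \<open>2 * pi\<close> is the gap between neighbouring values that the
    difference can take.\<close>
  then have "\<forall>\<^sub>F u in nhds x. dist (?h u) (?h x) < 2 * pi"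
    by (intro tendstoD) (auto simp: continuous_at_imp_continuous_at_within tendsto_nhds_iff isCont_def)
  moreover have "\<forall>\<^sub>F u in nhds x. u \<in> U"
    using assms(1,2) by (rule eventually_nhds_in_open)
  ultimately have "\<forall>\<^sub>F u in nhds x. ?h u = ?h x"
  proof eventually_elim
    case (elim u)
    obtain k l :: int where kl: "?h u = 2 * pi * of_int k" "?h x = 2 * pi * of_int l"
      using assms(3)[OF elim(2)] assms(3)[OF assms(2)] unfolding circ_eq_iff by blast
    then have "\<bar>2 * pi * real_of_int (k - l)\<bar> < 2 * pi"
      using elim(1) by (simp add: dist_real_def algebra_simps)
    then have "2 * pi * \<bar>real_of_int (k - l)\<bar> < 2 * pi * 1"
      by (simp add: abs_mult)
    then have "\<bar>real_of_int (k - l)\<bar> < 1"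
      by (subst (asm) mult_less_cancel_left_pos) auto
    then show ?case
      using kl by auto
  qed
  then obtain V where V: "open V" "x \<in> V" "\<And>u. u \<in> V \<Longrightarrow> ?h x = ?h u"
    unfolding eventually_nhds by metis
  have "(?h has_derivative (\<lambda>v. 0)) (at x)"
    by (rule has_derivative_transform_within_open[OF has_derivative_const V])
  then have "(\<lambda>v. f' v - g' v) = (\<lambda>v. 0)"
    using has_derivative_unique[OF h] by simp
  then show ?thesis
    by (simp add: fun_eq_iff)
qed

text \<open>The one-dimensional counterpart of \<open>torus_deriv\<close>, recorded as a real number
  so that it can serve as a coefficient.\<close>

definition circle_deriv :: "(circle \<Rightarrow> circle) \<Rightarrow> circle \<Rightarrow> real" where
  "circle_deriv \<phi> a = (THE d. \<exists>u U g. circ u = a \<and> u \<in> U \<and>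
     local_lift circ circ \<phi> U g \<and> (g has_real_derivative d) (at u))"

text \<open>Competing lifts may live near different points over the same angle. Translating one by
  the difference of these points, a multiple of \<open>2 * pi\<close>, brings both to
  \<open>u\<close>, where \<open>lift_derivative_unique\<close> compares them.\<close>

lemma circle_deriv_eq:
  assumes "local_lift circ circ \<phi> U g" "u \<in> U" "(g has_real_derivative d) (at u)"
  shows "circle_deriv \<phi> (circ u) = d"
  unfolding circle_deriv_def
proof (rule the_equality)
  show "\<exists>u' U g. circ u' = circ u \<and> u' \<in> U \<and>
     local_lift circ circ \<phi> U g \<and> (g has_real_derivative d) (at u')"
    using assms by blast
next
  fix d'
  assume "\<exists>u' U g. circ u' = circ u \<and> u' \<in> U \<and>
     local_lift circ circ \<phi> U g \<and> (g has_real_derivative d') (at u')"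
  then obtain w V h where w: "circ w = circ u" "w \<in> V" "local_lift circ circ \<phi> V h"
    "(h has_real_derivative d') (at w)"
    by blast
  obtain k :: int where k: "w - u = 2 * pi * of_int k"
    using w(1) unfolding circ_eq_iff by blast
  let ?t = "w - u"
  have shift: "circ (x + ?t) = circ x" for x
    unfolding circ_eq_iff using k by (intro exI[of _ k]) simp
  let ?W = "U \<inter> (\<lambda>x. x + ?t) -` V"
  have "open ?W"
    using assms(1) w(3) unfolding local_lift_def
    by (intro open_Int open_vimage continuous_intros) auto
  moreover have "u \<in> ?W"
    using assms(2) w(2) by simp
  moreover have "circ (h (x + ?t)) = circ (g x)" if "x \<in> ?W" for x
    using that assms(1) w(3) shift[of x] by (auto simp: local_lift_def)
  moreover have "((\<lambda>x. h (x + ?t)) has_derivative (*) d') (at u)"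
    using w(4) DERIV_shift[of h d' u ?t] by (simp add: has_field_derivative_def)
  moreover have "(g has_derivative (*) d) (at u)"
    using assms(3) by (simp add: has_field_derivative_def)
  ultimately have "(*) d' = (*) d"
    by (rule lift_derivative_unique)
  then show "d' = d"
    by (metis mult.right_neutral)
qed

text \<open>Differentiability of the lift, guaranteed by the order \<open>Suc k\<close>, makes the
  description in \<open>circle_deriv\<close> denote an actual derivative throughout
  \<open>U\<close>.\<close>

lemma circle_deriv_lift:
  assumes "Ck_map circ circ (Suc k) \<phi>"
  obtains U g where "u \<in> U" "local_lift circ circ \<phi> U g" "Ck_on (Suc k) U g"
    "\<forall>w\<in>U. (g has_real_derivative circle_deriv \<phi> (circ w)) (at w)"
proof -
  obtain U g where U: "u \<in> U" "local_lift circ circ \<phi> U g" "Ck_on (Suc k) U g"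
    using assms unfolding Ck_map_def by blast
  moreover have "\<forall>w\<in>U. (g has_real_derivative circle_deriv \<phi> (circ w)) (at w)"
  proof
    fix w
    assume "w \<in> U"
    obtain d where d: "(g has_real_derivative d) (at w)"
      using U(3) \<open>w \<in> U\<close> by (auto simp: real_differentiable_def)
    then show "(g has_real_derivative circle_deriv \<phi> (circ w)) (at w)"
      using circle_deriv_eq[OF U(2) \<open>w \<in> U\<close> d] by simp
  qed
  ultimately show thesis ..
qed

text \<open>Locally the function is the derivative of a lift in direction 1, so exactly one order is
  lost: C^3 circle maps yield C^2 coefficients.\<close>

lemma Ck_fun_circle_deriv:
  assumes "Ck_map circ circ (Suc k) \<phi>"
  shows "Ck_fun circ k (circle_deriv \<phi>)"
proof (rule Ck_fun_localI)
  fix x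
  obtain U g where U: "x \<in> U" "local_lift circ circ \<phi> U g" "Ck_on (Suc k) U g"
    "\<forall>w\<in>U. (g has_real_derivative circle_deriv \<phi> (circ w)) (at w)"
    by (rule circle_deriv_lift[OF assms, where u = x])
  have "circle_deriv \<phi> (circ w) = frechet_derivative g (at w) 1" if "w \<in> U" for w
    using frechet_derivative_at[OF U(4)[rule_format, OF that, unfolded has_field_derivative_def]]
    by (metis mult.right_neutral)
  then show "\<exists>U g. open U \<and> x \<in> U \<and> Ck_on k U g \<and> (\<forall>u\<in>U. circle_deriv \<phi> (circ u) = g u)"
    using U Ck_on_SucD(2)[OF U(3), of 1]
    by (intro exI[of _ U] exI[of _ "\<lambda>w. frechet_derivative g (at w) 1"])
      (auto simp: local_lift_def)
qed

text \<open>
  Existence of a differentiable lift is needed here: otherwise the description operator in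
  \<open>torus_deriv\<close> would return an unspecified value.
\<close>

lemma torus_deriv_node_respecting:
  fixes \<Phi> :: "circle ^ 'n \<Rightarrow> circle ^ 'n"
  assumes \<Phi>: "\<And>\<theta>. \<Phi> \<theta> = (\<chi> i. \<phi> i (\<theta> $ \<sigma> i))"
    and \<phi>: "\<And>i. Ck_map circ circ (Suc k) (\<phi> i)"
  shows "torus_deriv \<Phi> a v = (\<chi> i. circle_deriv (\<phi> i) (a $ \<sigma> i) * v $ \<sigma> i)"
proof -
  let ?L = "\<lambda>v. \<chi> i. circle_deriv (\<phi> i) (a $ \<sigma> i) * v $ \<sigma> i"
  \<comment> \<open>Component \<open>i\<close> of \<open>\<Phi>\<close> depends on coordinate
    \<open>\<sigma> i\<close> alone, so a lift of \<open>\<phi> i\<close> composed with that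
    coordinate lifts it. The point \<open>x\<close> over \<open>a\<close> stays arbitrary because
    existence and uniqueness use different ones.\<close>
  have comp: "\<exists>V h. open V \<and> x \<in> V \<and> (\<forall>u\<in>V. circ (h u) = \<Phi> (torus_proj u) $ i) \<and>
      (h has_derivative (\<lambda>v. circle_deriv (\<phi> i) (a $ \<sigma> i) * v $ \<sigma> i)) (at x)"
    if "torus_proj x = a" for x i
  proof -
    obtain U g where U: "x $ \<sigma> i \<in> U" "local_lift circ circ (\<phi> i) U g"
      "Ck_on (Suc k) U g" "\<forall>w\<in>U. (g has_real_derivative circle_deriv (\<phi> i) (circ w)) (at w)"
      by (rule circle_deriv_lift[OF \<phi>[of i], where u = "x $ \<sigma> i"])
    have "a $ \<sigma> i = circ (x $ \<sigma> i)"
      using that by (auto simp: torus_proj_def)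
    then have "((\<lambda>u. g (u $ \<sigma> i)) has_derivative
        (\<lambda>v. circle_deriv (\<phi> i) (a $ \<sigma> i) * v $ \<sigma> i)) (at x)"
      using has_derivative_compose[OF
          bounded_linear_imp_has_derivative[OF bounded_linear_vec_nth, of "\<sigma> i"]
          U(4)[rule_format, OF U(1), unfolded has_field_derivative_def]] by simp
    moreover have "open ((\<lambda>u. u $ \<sigma> i) -` U)"
      using U(2) by (intro open_vimage continuous_intros) (simp add: local_lift_def)
    ultimately show ?thesis
      using U(1,2)
      by (intro exI[of _ "(\<lambda>u. u $ \<sigma> i) -` U"] exI[of _ "\<lambda>u. g (u $ \<sigma> i)"])
        (auto simp: local_lift_def \<Phi> torus_proj_def)
  qed
  have "torus_deriv \<Phi> a = ?L"
    unfolding torus_deriv_def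
  proof (rule the_equality)
    define x where "x = (\<chi> i. SOME t. circ t = a $ i)"
    have x: "torus_proj x = a"
      using someI_ex[OF surj_circ] by (simp add: x_def torus_proj_def vec_eq_iff)
    obtain V h where V: "\<And>i. open (V i)" "\<And>i. x \<in> V i"
      "\<And>i u. u \<in> V i \<Longrightarrow> circ (h i u) = \<Phi> (torus_proj u) $ i"
      "\<And>i. (h i has_derivative (\<lambda>v. circle_deriv (\<phi> i) (a $ \<sigma> i) * v $ \<sigma> i)) (at x)"
      using comp[OF x] by metis
    have "((\<lambda>u. \<chi> i. h i u) has_derivative ?L) (at x)"
      by (subst has_derivative_componentwise_within)
        (auto simp: Basis_vec_def inner_axis intro: V(4))
    \<comment> \<open>The component lifts have different domains; their intersection is open because
      the index type is finite.\<close>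
    moreover have "local_lift torus_proj torus_proj \<Phi> (\<Inter>i. V i) (\<lambda>u. \<chi> i. h i u)"
      using V(1,3) by (auto simp: local_lift_def torus_proj_def vec_eq_iff)
    ultimately show "\<exists>x U g. torus_proj x = a \<and> x \<in> U \<and>
        local_lift torus_proj torus_proj \<Phi> U g \<and> (g has_derivative ?L) (at x)"
      using x V(2) by blast
  next
    fix L
    assume "\<exists>x U g. torus_proj x = a \<and> x \<in> U \<and>
        local_lift torus_proj torus_proj \<Phi> U g \<and> (g has_derivative L) (at x)"
    then obtain x U g where x: "torus_proj x = a" "x \<in> U"
      and g: "local_lift torus_proj torus_proj \<Phi> U g" "(g has_derivative L) (at x)"
      by blast
    \<comment> \<open>Coordinate \<open>i\<close> of an arbitrary lift and the special lift from
      \<open>comp\<close> cover the same circle-valued function, so their derivatives at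
      \<open>x\<close> coincide.\<close>
    have "(\<lambda>v. L v $ i) = (\<lambda>v. ?L v $ i)" for i
    proof -
      obtain V h where V: "open V" "x \<in> V"
        "\<And>u. u \<in> V \<Longrightarrow> circ (h u) = \<Phi> (torus_proj u) $ i"
        "(h has_derivative (\<lambda>v. ?L v $ i)) (at x)"
        using comp[OF x(1), of i] by auto
      show ?thesis
      proof (rule lift_derivative_unique)
        show "open (U \<inter> V)" "x \<in> U \<inter> V"
          using V x g(1) by (auto simp: local_lift_def)
        show "circ (g u $ i) = circ (h u)" if "u \<in> U \<inter> V" for u
          using that V(3)[of u] g(1) by (simp add: local_lift_def) (simp add: torus_proj_def)
        show "((\<lambda>u. g u $ i) has_derivative (\<lambda>v. L v $ i)) (at x)"
          by (rule bounded_linear.has_derivative[OF bounded_linear_vec_nth g(2)])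
        show "(h has_derivative (\<lambda>v. ?L v $ i)) (at x)"
          by (rule V(4))
      qed
    qed
    then show "L = ?L"
      by (simp add: fun_eq_iff vec_eq_iff)
  qed
  then show ?thesis by simp
qed

section \<open>Pairwise vector fields\<close>

text \<open>The C^2 regularity of the whole field follows from the pairwise formula, since each
  summand is a C^2 function of two coordinates of the torus.\<close>

lemma V_pairI:
  fixes H :: "circle ^ 'n \<Rightarrow> real ^ 'n"
  assumes "\<And>i k. Ck_fun torus2_proj 2 (G i k)"
    and "\<And>\<theta> i. H \<theta> $ i = (\<Sum>k\<in>UNIV. G i k (\<theta> $ i, \<theta> $ k))"
  shows "H \<in> V_pair"
proof -
  have "Ck_fun torus_proj 2 (\<lambda>\<theta>. \<chi> i. \<Sum>k\<in>UNIV. G i k (\<theta> $ i, \<theta> $ k))"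
    by (intro Ck_fun_vec Ck_fun_sum Ck_fun_compose[OF _ assms(1)] Ck_map_Pair Ck_map_nth)
  moreover have "H = (\<lambda>\<theta>. \<chi> i. \<Sum>k\<in>UNIV. G i k (\<theta> $ i, \<theta> $ k))"
    by (simp add: fun_eq_iff vec_eq_iff assms(2))
  ultimately have "Ck_fun torus_proj 2 H"
    by simp
  then show ?thesis
    using assms unfolding V_pair_def by blast
qed

theorem proposition2p4:
  fixes F :: "circle ^ 'n \<Rightarrow> real ^ 'n"
    and \<Phi> :: "circle ^ 'n \<Rightarrow> circle ^ 'n"
  assumes "F \<in> V_pair"
    and "node_respecting \<Phi>"
  shows "pushforward \<Phi> F \<in> V_pair"
proof -
  obtain G where G: "\<And>i j. Ck_fun torus2_proj 2 (G i j)"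
    and F: "\<And>\<theta> i. F \<theta> $ i = (\<Sum>j\<in>UNIV. G i j (\<theta> $ i, \<theta> $ j))"
    using assms(1) unfolding V_pair_def mem_Collect_eq by metis
  obtain \<sigma> \<phi> where \<sigma>: "\<sigma> permutes UNIV" and diffeo: "\<And>i. Ck_diffeo circ 3 (\<phi> i)"
    and \<Phi>: "\<And>\<theta>. \<Phi> \<theta> = (\<chi> i. \<phi> i (\<theta> $ \<sigma> i))" and "bij \<Phi>"
    using assms(2) unfolding node_respecting_def Ck_diffeo_def by blast
  define \<psi> where "\<psi> i = inv (\<phi> i)" for i
  have bij: "bij (\<phi> i)" and \<phi>3: "Ck_map circ circ (Suc 2) (\<phi> i)"
    and \<psi>2: "Ck_map circ circ 2 (\<psi> i)" for i
    using diffeo[of i] Ck_map_le[of circ circ 3 "\<psi> i" 2]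
    by (auto simp: Ck_diffeo_def \<psi>_def numeral_3_eq_3 numeral_2_eq_2)
  \<comment> \<open>Reading coordinate \<open>i\<close> of \<open>\<Phi> (inv \<Phi> y) = y\<close>
    and cancelling the injective \<open>\<phi> i\<close> determines the inverse at index
    \<open>\<sigma> i\<close>, without an explicit inverse permutation.\<close>
  have inv\<Phi>: "inv \<Phi> y $ \<sigma> i = \<psi> i (y $ i)" for y i
  proof -
    have "\<phi> i (inv \<Phi> y $ \<sigma> i) = \<Phi> (inv \<Phi> y) $ i"
      by (simp add: \<Phi>)
    also have "\<dots> = y $ i"
      using \<open>bij \<Phi>\<close> by (simp add: bij_is_surj surj_f_inv_f)
    finally show ?thesis
      using bij[of i] by (simp add: \<psi>_def bij_is_inj inv_f_eq)
  qed
  \<comment> \<open>The derivative factor depends only on the first variable, so it can be absorbed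
    into every interaction term while keeping the pairwise form.\<close>
  define H where "H i k = (\<lambda>(a, b). circle_deriv (\<phi> i) (\<psi> i a) * G (\<sigma> i) (\<sigma> k) (\<psi> i a, \<psi> k b))"
    for i k
  show ?thesis
  proof (rule V_pairI)
    have fst: "Ck_map torus2_proj circ 2 (\<lambda>z. \<psi> i (fst z))" for i
      by (rule Ck_map_compose[OF Ck_map_fst \<psi>2])
    have snd: "Ck_map torus2_proj circ 2 (\<lambda>z. \<psi> i (snd z))" for i
      by (rule Ck_map_compose[OF Ck_map_snd \<psi>2])
    show "Ck_fun torus2_proj 2 (H i k)" for i k
      unfolding H_def case_prod_unfold
      by (intro Ck_fun_mult Ck_fun_compose[OF fst Ck_fun_circle_deriv[OF \<phi>3]]
          Ck_fun_compose[OF Ck_map_Pair[OF fst snd] G])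
  next
    fix y i
    have "pushforward \<Phi> F y $ i =
        circle_deriv (\<phi> i) (\<psi> i (y $ i)) * (\<Sum>j\<in>UNIV. G (\<sigma> i) j (\<psi> i (y $ i), inv \<Phi> y $ j))"
      by (simp add: pushforward_def torus_deriv_node_respecting[OF \<Phi> \<phi>3] F inv\<Phi>)
    also have "(\<Sum>j\<in>UNIV. G (\<sigma> i) j (\<psi> i (y $ i), inv \<Phi> y $ j)) =
        (\<Sum>k\<in>UNIV. G (\<sigma> i) (\<sigma> k) (\<psi> i (y $ i), \<psi> k (y $ k)))"
      \<comment> \<open>Reindexing by \<open>\<sigma>\<close> turns coordinate \<open>j\<close> of
        the inverse into one at \<open>\<sigma> k\<close>, which \<open>inv\<Phi>\<close> expresses
        through \<open>y $ k\<close> alone.\<close>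
      by (subst sum.permute[OF \<sigma>]) (simp add: o_def inv\<Phi>)
    finally show "pushforward \<Phi> F y $ i = (\<Sum>k\<in>UNIV. H i k (y $ i, y $ k))"
      by (simp add: H_def sum_distrib_left)
  qed
qed

end
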